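(* Let $\beta>2$ be an irrational number and let $S=\{\lfloor \beta n\rfloor \mid n\in\mathbb{Z}_{>0}\}$. Let $\alpha$ be defined by $\frac{1}{\alpha}+\frac{1}{\beta}=1$. Then a legal position $(x,y)$ of 2-pile $S$-Nim is a previous-player winning position (P-position) if and only if, up to swapping the two heaps, $(x,y)=(\lfloor\alpha n\rfloor,\lfloor\beta n\rfloor)$ for some $n\in\mathbb{Z}_{\ge 0}$.
   Context: Black \& white Nim: fix $S\subset\mathbb{Z}_{>0}$. Tokens in each heap are colored: for each heap, the $n$-th token from the bottom is black if $n\in S$ and white otherwise. A heap of size $h$ is called black if $h=0$ or $h\in S$ (i.e. its top token is black or it is empty), and white otherwise. In 2-pile $S$-Nim there are always exactly two heaps (empty heaps still count as heaps); a position is an unordered pair $(x,y)$ of nonnegative heap sizes, and a position is legal if at least one of its two heaps is black. Starting positions are required to be legal. Two players alternate; a move is a Nim move (remove a positive number of tokens from one heap) such that the resulting position is legal. The player who cannot move loses (normal play). A P-position is one from which the previous player (the one who just moved) wins with optimal play. *)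

theory Defs
  imports Complex_Main "HOL-Library.Uprod"
begin

(* Normal play: a player who has no move loses.  Read as least fixed points, the two
   predicates say that the previous player, respectively the player to move, can force
   a win in finitely many moves. *)
inductive P_position :: "('p \<Rightarrow> 'p \<Rightarrow> bool) \<Rightarrow> 'p \<Rightarrow> bool"
  and N_position :: "('p \<Rightarrow> 'p \<Rightarrow> bool) \<Rightarrow> 'p \<Rightarrow> bool"
  for move :: "'p \<Rightarrow> 'p \<Rightarrow> bool"
  where
    P_positionI: "(\<And>q. move p q \<Longrightarrow> N_position move q) \<Longrightarrow> P_position move p"
  | N_positionI: "move p q \<Longrightarrow> P_position move q \<Longrightarrow> N_position move p"

definition black_heap :: "nat set \<Rightarrow> nat \<Rightarrow> bool"
  where "black_heap S h \<longleftrightarrow> h = 0 \<or> h \<in> S"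

definition legal :: "nat set \<Rightarrow> nat uprod \<Rightarrow> bool"
  where "legal S p \<longleftrightarrow> (\<exists>h \<in> set_uprod p. black_heap S h)"

(* Positions are unordered pairs, so this single rule covers a move in either heap. *)
inductive S_nim_move :: "nat set \<Rightarrow> nat uprod \<Rightarrow> nat uprod \<Rightarrow> bool"
  for S :: "nat set"
  where "x' < x \<Longrightarrow> legal S (Upair x' y) \<Longrightarrow> S_nim_move S (Upair x y) (Upair x' y)"

end

(* The pairs (\<lfloor>\<alpha> n\<rfloor>, \<lfloor>\<beta> n\<rfloor>) form a kernel of the move graph.  By Beatty's theorem
   every positive heap size is exactly one of \<lfloor>\<alpha> n\<rfloor> (white) and \<lfloor>\<beta> n\<rfloor> (black), so no
   two of the pairs share a heap.  From a legal position that is not a pair, keep a black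
   heap \<lfloor>\<beta> i\<rfloor> and lower the other one to its partner \<lfloor>\<alpha> i\<rfloor>; if the other heap is a white
   \<lfloor>\<alpha> j\<rfloor> with j < i, lower the black heap to \<lfloor>\<beta> j\<rfloor> instead. *)
theory Submission
  imports Defs
begin

section \<open>Normal play and kernels of a move graph\<close>

lemma P_position_not_N_position:
  "P_position move p \<Longrightarrow> \<not> N_position move p"
  "N_position move p \<Longrightarrow> \<not> P_position move p"
proof (induction rule: P_position_N_position.inducts)
  case (P_positionI p)
  show ?case
  proof
    assume "N_position move p"
    then show False
      by cases (use P_positionI in blast)
  qed
next
  case (N_positionI p q)
  show ?case
  proof
    assume "P_position move p"
    then show False
      by cases (use N_positionI in blast)
  qed
qed

text \<open>By well-founded induction along moves, members of \<open>K\<close> are P-positions,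
  since every move leaves \<open>K\<close>, and the others are N-positions, since some move enters
  \<open>K\<close>. The predicate \<open>L\<close> stands for legality: absorption is demanded only
  there, and \<open>closed\<close> keeps the induction inside \<open>L\<close>.\<close>

lemma P_position_iff_kernel:
  assumes wf: "wfp (\<lambda>q p. move p q)"
    and closed: "\<And>p q. L p \<Longrightarrow> move p q \<Longrightarrow> L q"
    and independent: "\<And>p q. p \<in> K \<Longrightarrow> move p q \<Longrightarrow> q \<notin> K"
    and absorbing: "\<And>p. L p \<Longrightarrow> p \<notin> K \<Longrightarrow> \<exists>q\<in>K. move p q"
    and "L p"
  shows "P_position move p \<longleftrightarrow> p \<in> K"
proof -
  have "(p \<in> K \<longrightarrow> P_position move p) \<and> (p \<notin> K \<longrightarrow> N_position move p)"
    using wf \<open>L p\<close>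
  proof (induction p rule: wfp_induct_rule)
    case (less p)
    then show ?case
      by (metis P_positionI N_positionI closed independent absorbing)
  qed
  then show ?thesis
    by (cases "p \<in> K") (auto dest: P_position_not_N_position)
qed

section \<open>Nim moves on unordered pairs\<close>

lemma Upair_commute: "Upair x y = Upair y x"
  by simp

lemma S_nim_move_right:
  "y' < y \<Longrightarrow> legal S (Upair x y') \<Longrightarrow> S_nim_move S (Upair x y) (Upair x y')"
  using S_nim_move.intros[of y' y S x] by (simp add: Upair_commute[of x])

lemma S_nim_move_Upair_iff:
  "S_nim_move S (Upair x y) q \<longleftrightarrow>
    legal S q \<and> ((\<exists>x'<x. q = Upair x' y) \<or> (\<exists>y'<y. q = Upair x y'))"
proof
  assume "S_nim_move S (Upair x y) q"
  then show "legal S q \<and> ((\<exists>x'<x. q = Upair x' y) \<or> (\<exists>y'<y. q = Upair x y'))"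
    by cases auto
next
  show "legal S q \<and> ((\<exists>x'<x. q = Upair x' y) \<or> (\<exists>y'<y. q = Upair x y')) \<Longrightarrow>
      S_nim_move S (Upair x y) q"
    by (auto intro: S_nim_move.intros S_nim_move_right)
qed

text \<open>Each move lowers the total number of tokens.\<close>

lemma wfp_S_nim_move: "wfp (\<lambda>q p. S_nim_move S p q)"
proof (rule wfpUNIVI)
  fix P :: "nat uprod \<Rightarrow> bool" and p
  assume step: "\<forall>p. (\<forall>q. S_nim_move S p q \<longrightarrow> P q) \<longrightarrow> P p"
  have "P (Upair x y)" for x y
  proof (induction "x + y" arbitrary: x y rule: less_induct)
    case less
    show ?case
    proof (rule step[rule_format])
      fix q assume "S_nim_move S (Upair x y) q"
      then obtain x' y' where "q = Upair x' y'" "x' + y' < x + y"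
        by (fastforce simp: S_nim_move_Upair_iff)
      then show "P q"
        using less by simp
    qed
  qed
  then show "P p"
    by (cases p) simp
qed

section \<open>Beatty's theorem\<close>

lemma irrational_mult_nat_neq:
  assumes "\<beta> \<notin> \<rat>" "n > 0"
  shows "\<beta> * real n \<noteq> real k"
proof
  assume "\<beta> * real n = real k"
  then have "\<beta> = real k / real n"
    using assms(2) by (simp add: field_simps)
  with assms(1) show False by simp
qed

lemma nat_floor_eq_iff:
  "x \<ge> 0 \<Longrightarrow> nat \<lfloor>x\<rfloor> = k \<longleftrightarrow> real k \<le> x \<and> x < real k + 1"
  by (auto simp: floor_eq_iff nat_eq_iff)

text \<open>A common value \<open>k\<close> gives bounds on \<open>n\<close> and \<open>m\<close> by
  \<open>k\<close> and \<open>k + 1\<close> divided by \<alpha> and \<beta>. Adding them, with the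
  reciprocals summing to 1, puts the integer \<open>n + m\<close> strictly between \<open>k\<close>
  and \<open>k + 1\<close>.\<close>

theorem beatty_disjoint:
  fixes \<alpha> \<beta> :: real
  assumes "\<alpha> > 0" "\<beta> > 0" "\<beta> \<notin> \<rat>" and inv: "1 / \<alpha> + 1 / \<beta> = 1" and "m > 0"
  shows "nat \<lfloor>\<alpha> * real n\<rfloor> \<noteq> nat \<lfloor>\<beta> * real m\<rfloor>"
proof
  define k where "k = nat \<lfloor>\<beta> * real m\<rfloor>"
  assume "nat \<lfloor>\<alpha> * real n\<rfloor> = nat \<lfloor>\<beta> * real m\<rfloor>"
  then have "real k \<le> \<alpha> * n" "\<alpha> * n < real k + 1" "real k \<le> \<beta> * m" "\<beta> * m < real k + 1"
    using assms nat_floor_eq_iff[of "\<alpha> * n" k] nat_floor_eq_iff[of "\<beta> * m" k]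
    by (auto simp: k_def)
  \<comment> \<open>Irrationality makes one lower bound strict, which excludes
    \<open>n + m = k\<close>.\<close>
  moreover have "\<beta> * m \<noteq> k"
    using assms by (intro irrational_mult_nat_neq)
  ultimately have "real k / \<alpha> \<le> n" "n < (real k + 1) / \<alpha>" "k / \<beta> < m" "m < (real k + 1) / \<beta>"
    using assms by (auto simp: field_simps)
  moreover have "x / \<alpha> + x / \<beta> = x" for x
    using arg_cong[OF inv, of "\<lambda>t. x * t"] by (simp add: distrib_left)
  from this[of k] this[of "real k + 1"] calculation have "real k < n + m" "real (n + m) < real (k + 1)"
    by linarith+
  then show False
    unfolding of_nat_less_iff by linarith
qed

text \<open>If both sequences miss \<open>k\<close>, the multiples of \<alpha> and of \<beta> each
  jump over the interval from \<open>k\<close> to \<open>k + 1\<close>, after \<open>n\<close> and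
  \<open>m\<close> steps. Dividing and adding puts \<open>k\<close> strictly between
  \<open>n + m\<close> and \<open>n + m + 1\<close>.\<close>

theorem beatty_cover:
  fixes \<alpha> \<beta> :: real
  assumes "\<alpha> > 0" "\<beta> > 0" "\<beta> \<notin> \<rat>" and inv: "1 / \<alpha> + 1 / \<beta> = 1" and "k > 0"
  obtains n where "n > 0" "k = nat \<lfloor>\<alpha> * real n\<rfloor>" | n where "n > 0" "k = nat \<lfloor>\<beta> * real n\<rfloor>"
proof (rule ccontr)
  assume "\<not> thesis"
  with that have not_hit: "k \<noteq> nat \<lfloor>\<alpha> * real (Suc n)\<rfloor>" "k \<noteq> nat \<lfloor>\<beta> * real (Suc n)\<rfloor>" for n
    by blast+
  have gap: "\<exists>n. \<gamma> * real n < k \<and> k + 1 \<le> \<gamma> * real (Suc n)"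
    if "\<gamma> > 0" and "\<And>n. k \<noteq> nat \<lfloor>\<gamma> * real (Suc n)\<rfloor>" for \<gamma> :: real
  proof -
    \<comment> \<open>The last index whose multiple of \<gamma> is strictly below \<open>k\<close>;
      it may be 0, so only \<open>Suc n\<close> is known to be a positive index.\<close>
    define n where "n = nat (\<lceil>k / \<gamma>\<rceil> - 1)"
    have "k / \<gamma> > 0"
      using that \<open>k > 0\<close> by simp
    then have "real n < k / \<gamma>" "k / \<gamma> \<le> real (Suc n)"
      unfolding n_def by linarith+
    then have "\<gamma> * real n < k" "k \<le> \<gamma> * real (Suc n)"
      using that(1) by (simp_all add: field_simps)
    moreover have "\<not> \<gamma> * real (Suc n) < real k + 1"
      using that nat_floor_eq_iff[of "\<gamma> * real (Suc n)" k] calculation(2) by auto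
    ultimately show ?thesis by auto
  qed
  obtain n where n: "\<alpha> * real n < k" "k + 1 \<le> \<alpha> * real (Suc n)"
    using gap[of \<alpha>] not_hit assms by blast
  obtain m where m: "\<beta> * real m < k" "k + 1 \<le> \<beta> * real (Suc m)"
    using gap[of \<beta>] not_hit assms by blast
  \<comment> \<open>Irrationality makes one upper bound strict, which excludes
    \<open>k = n + m + 1\<close>.\<close>
  have "\<beta> * real (Suc m) \<noteq> real (k + 1)"
    using assms by (intro irrational_mult_nat_neq) auto
  then have "n < k / \<alpha>" "(real k + 1) / \<alpha> \<le> real n + 1" "m < k / \<beta>" "(real k + 1) / \<beta> < real m + 1"
    using assms n m by (auto simp: field_simps)
  moreover have "x / \<alpha> + x / \<beta> = x" for x
    using arg_cong[OF inv, of "\<lambda>t. x * t"] by (simp add: distrib_left)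
  from this[of k] this[of "real k + 1"] calculation have "real (n + m) < real k" "real k < real (n + m + 1)"
    by linarith+
  then show False
    unfolding of_nat_less_iff by linarith
qed

lemma strict_mono_nat_floor_mult:
  fixes \<gamma> :: real
  assumes "\<gamma> \<ge> 1"
  shows "strict_mono (\<lambda>n. nat \<lfloor>\<gamma> * real n\<rfloor>)"
proof (rule strict_mono_Suc_iff[THEN iffD2], rule allI)
  fix n
  have "\<gamma> * real (Suc n) \<ge> \<gamma> * n + 1" "\<gamma> * n \<ge> 0"
    using assms by (simp_all add: distrib_left)
  then show "nat \<lfloor>\<gamma> * real n\<rfloor> < nat \<lfloor>\<gamma> * real (Suc n)\<rfloor>"
    by linarith
qed

section \<open>The Beatty pairs as a kernel\<close>

theorem theorem2:
  fixes \<alpha> \<beta> :: real and S :: "nat set" and x y :: nat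
  assumes "\<beta> > 2" and "\<beta> \<notin> \<rat>"
    and "S = {nat \<lfloor>\<beta> * real n\<rfloor> | n :: nat. n > 0}"
    and "1 / \<alpha> + 1 / \<beta> = 1"
    and "legal S (Upair x y)"
  shows "P_position (S_nim_move S) (Upair x y) \<longleftrightarrow>
    (\<exists>n :: nat. Upair x y = Upair (nat \<lfloor>\<alpha> * real n\<rfloor>) (nat \<lfloor>\<beta> * real n\<rfloor>))"
proof -
  define a where "a n = nat \<lfloor>\<alpha> * real n\<rfloor>" for n
  define b where "b n = nat \<lfloor>\<beta> * real n\<rfloor>" for n
  define K where "K = range (\<lambda>n. Upair (a n) (b n))"
  \<comment> \<open>From \<beta> > 2 follows 1 < \<alpha> < 2 < \<beta>: the lower bound makes
    \<open>a\<close> strictly increasing, and \<alpha> < \<beta> yields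
    \<open>ab_le\<close>.\<close>
  have "1 / \<alpha> = 1 - 1 / \<beta>" "1 / \<beta> < 1 / 2" "1 / \<beta> > 0"
    using assms(1,4) by (simp_all add: field_simps)
  then have "1 / \<alpha> > 1 / 2" "1 / \<alpha> < 1"
    by linarith+
  moreover from this have "\<alpha> > 0"
    using zero_less_divide_1_iff[of \<alpha>] by linarith
  ultimately have \<alpha>: "1 < \<alpha>" "\<alpha> < 2"
    by (simp_all add: field_simps)
  have smono: "strict_mono a" "strict_mono b"
    using strict_mono_nat_floor_mult[of \<alpha>] strict_mono_nat_floor_mult[of \<beta>] \<alpha> assms(1)
    by (simp_all add: a_def[abs_def] b_def[abs_def])
  have zero [simp]: "a 0 = 0" "b 0 = 0"
    by (simp_all add: a_def b_def)
  have eq_iff [simp]: "a i = a j \<longleftrightarrow> i = j" "b i = b j \<longleftrightarrow> i = j"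
    and less_iff [simp]: "a i < a j \<longleftrightarrow> i < j" "b i < b j \<longleftrightarrow> i < j" for i j
    using smono by (simp_all add: strict_mono_eq strict_mono_less)
  have ab_eq: "a i = b j \<longleftrightarrow> i = 0 \<and> j = 0" for i j
  proof (cases "j = 0")
    case True
    then show ?thesis
      using eq_iff(1)[of i 0] by simp
  next
    case False
    then show ?thesis
      using beatty_disjoint[of \<alpha> \<beta> j i] \<alpha> assms by (simp add: a_def b_def)
  qed
  have ab_le: "a i \<le> b i" for i
  proof -
    have "\<alpha> * real i \<le> \<beta> * real i"
      using \<alpha> assms(1) by (intro mult_right_mono) auto
    then show ?thesis
      unfolding a_def b_def by (intro nat_mono floor_mono)
  qed
  \<comment> \<open>Index 0, absent from \<open>S\<close>, accounts for the empty heap.\<close>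
  have black: "black_heap S h \<longleftrightarrow> h \<in> range b" for h
    unfolding black_heap_def assms(3) b_def[symmetric]
    by (simp add: image_iff) (metis neq0_conv zero(2))
  have cover: "h \<in> range a \<union> range b" for h
  proof (cases "h = 0")
    case True
    then show ?thesis using zero by (metis UnI1 rangeI)
  next
    case False
    have pos: "0 < \<alpha>" "0 < \<beta>" "h > 0"
      using \<alpha> assms(1) False by simp_all
    show ?thesis
      by (rule beatty_cover[OF pos(1,2) assms(2,4) pos(3)]) (auto simp: a_def b_def)
  qed
  have pair: "Upair (a n) (b n) \<in> K" "legal S (Upair (a n) (b n))" for n
    unfolding K_def by (rule rangeI) (simp add: legal_def black)
  have "P_position (S_nim_move S) (Upair x y) \<longleftrightarrow> Upair x y \<in> K"
  proof (rule P_position_iff_kernel[where L = "legal S"])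
    show "wfp (\<lambda>q p. S_nim_move S p q)"
      by (rule wfp_S_nim_move)
    show "legal S q" if "S_nim_move S p q" for p q
      using that by cases simp
    \<comment> \<open>A move keeps one heap. If two pairs share it in the same role, their indices
      agree and nothing was removed; if in opposite roles, \<open>ab_eq\<close> makes both pairs
      empty.\<close>
    show "q \<notin> K" if "p \<in> K" "S_nim_move S p q" for p q
    proof
      assume "q \<in> K"
      with \<open>p \<in> K\<close> obtain i j where "p = Upair (a i) (b i)" "q = Upair (a j) (b j)"
        by (auto simp: K_def)
      with \<open>S_nim_move S p q\<close> show False
        using ab_eq[of i j] ab_eq[of j i]
        by (auto simp: S_nim_move_Upair_iff)
    qed
    show "\<exists>q\<in>K. S_nim_move S p q" if "legal S p" "p \<notin> K" for p
    proof -
      obtain i h where p: "p = Upair h (b i)"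
      proof -
        obtain u v where "p = Upair u v"
          by (cases p)
        with \<open>legal S p\<close> consider i where "p = Upair u (b i)" | i where "p = Upair v (b i)"
          by (auto simp: legal_def black Upair_commute)
        then show ?thesis
          by cases (erule that)+
      qed
      have to_a: ?thesis if "a i < h"
        using p S_nim_move.intros[OF that pair(2)] pair(1) by blast
      have to_b: ?thesis if "h = a j" "j < i" for j
        using p that S_nim_move_right[OF _ pair(2)[of j], of "b i"] pair(1)[of j] by auto
      consider j where "h = a j" | j where "h = b j"
        using cover[of h] by auto
      then show ?thesis
      proof cases
        case 1
        with p \<open>p \<notin> K\<close> have "i \<noteq> j" by (auto simp: K_def)
        then show ?thesis using 1 to_a to_b by (metis less_iff(1) linorder_neqE_nat)
      next
        \<comment> \<open>Both heaps are black: the one of smaller index is kept and the other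
          lowered to its partner, which is low enough by \<open>ab_le\<close>.\<close>
        case 2
        show ?thesis
        proof (cases "i \<le> j")
          case True
          then have "a i \<le> h"
            using 2 ab_le[of i] less_iff(2)[of j i] by linarith
          moreover have "a i \<noteq> h"
            \<comment> \<open>Equality would force \<open>i = j = 0\<close>, but the empty position
              is the pair of index 0 and lies in \<open>K\<close>.\<close>
            using 2 p \<open>p \<notin> K\<close> ab_eq[of i j] pair(1)[of 0] by auto
          ultimately show ?thesis
            using to_a by simp
        next
          case False
          then have "a j < b i"
            using ab_le[of j] less_iff(2)[of j i] by linarith
          then show ?thesis
            using 2 p S_nim_move.intros[OF _ pair(2)[of j], of "b i"] pair(1)[of j]
            by (metis Upair_commute)
        qed
      qed
    qed
  qed (fact assms(5))
  then show ?thesis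
    by (auto simp: K_def a_def b_def)
qed

end
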